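(* Let $M\ge 2$ be an integer, $S=\{0,1,\dots,M\}$, and let $P\colon S\times S\to[0,1]$ satisfy $P(a,0)=1$ and $P(0,b)=0$ for all $a,b\in S\setminus\{0\}$, and $$P(x,a)\,P(x+a,b)\le P(x,a+b)$$ for every $x\in\{0,\dots,M\}$, $a\in\{0,\dots,M-x\}$ and $b\in\{0,\dots,M-a\}$. Suppose further that the map $\varphi\colon S\to[0,1]$, $\varphi(x)=P(x,1)$, is nondecreasing and satisfies $$\varphi(y)-\varphi(x)\le \varphi(x-y)\,[\varphi(y)-1]\qquad\text{for all } x,y\in S \text{ with } y\le x.$$ Then the bold-timid profile (player I plays the bold strategy, player II plays the timid strategy) is a Nash equilibrium of the two-person red-and-black game with total fortune $M$ and win probability function $P$.
   Context: The two-person red-and-black game with total fortune $M$ (an integer $M\ge2$) and win probability function $P\colon S\times S\to[0,1]$, $S=\{0,\dots,M\}$, is as follows. Player I has initial fortune $x_0\in\mathbb N$ and player II has initial fortune $y_0\in\mathbb N$ (positive integers) with $x_0+y_0=M$. $X_n$ and $Y_n$ denote the fortunes of players I and II at stage $n\in\mathbb N$; $X_1=x_0$, $Y_1=y_0$. At stage $n$ the players simultaneously bid integers $a_n\in\{0,\dots,X_n\}$ (player I) and $b_n\in\{0,\dots,Y_n\}$ (player II), each without knowledge of the other's current bid; a player whose fortune is positive is not allowed to bid $0$. Given the bids, $$X_{n+1}=X_n+b_n \text{ with probability } P(a_n,b_n),\qquad X_{n+1}=X_n-a_n \text{ with probability } 1-P(a_n,b_n),$$ and $Y_{n+1}=M-X_{n+1}$.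 Under the boundary conditions $P(a,0)=1$, $P(0,b)=0$ for $a,b\ne0$, the states $X_n=0$ and $X_n=M$ are absorbing, and the game effectively ends when one of them is reached. The goal of each player is to reach fortune $M$ (player I: $X_m=M$ for some $m$; player II: $Y_m=M$, i.e. $X_m=0$, for some $m$). The value $P(0,0)$ is never used in the game and is an arbitrary number in $[0,1]$. A strategy of a player is a rule which at each stage $n$ prescribes an admissible bid as a function of the partial history $(X_1,\dots,X_n)$. The timid strategy: bid exactly one unit at each stage (while the own fortune is positive). The bold strategy: bid the entire current fortune at each stage. A pair of strategies is a Nash equilibrium if each player's strategy maximizes, among all strategies of that player and against the opponent's given strategy, the probability that the player reaches the goal $M$. *)

theory Defs
  imports "HOL-Probability.Probability"
begin

text \<open>
  A history is the list \<open>[X\<^sub>1, \<dots>, X\<^sub>n]\<close> of fortunes of player I up to the present stage; as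
  \<open>Y\<^sub>i = M - X\<^sub>i\<close>, it also determines the fortunes of player II.
\<close>

type_synonym strategy = "nat list \<Rightarrow> nat"

definition admissible_bids :: "nat \<Rightarrow> nat set" where
  "admissible_bids z = {a. a \<le> z \<and> (0 < z \<longrightarrow> 0 < a)}"

definition histories :: "nat \<Rightarrow> nat list set" where
  "histories M = {h. h \<noteq> [] \<and> set h \<subseteq> {0..M}}"

definition strategies_I :: "nat \<Rightarrow> strategy set" where
  "strategies_I M = {\<sigma>. \<forall>h\<in>histories M. \<sigma> h \<in> admissible_bids (last h)}"

definition strategies_II :: "nat \<Rightarrow> strategy set" where
  "strategies_II M = {\<tau>. \<forall>h\<in>histories M. \<tau> h \<in> admissible_bids (M - last h)}"

definition bold_I :: strategy where
  "bold_I h = last h"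

definition timid_II :: "nat \<Rightarrow> strategy" where
  "timid_II M h = (if 0 < M - last h then 1 else 0)"

text \<open>
  One stage of the game from fortune \<open>x\<close> of player I with bids \<open>a\<close>, \<open>b\<close>. The subtraction does not
  truncate since admissible bids satisfy \<open>a \<le> x\<close>; \<^const>\<open>bernoulli_pmf\<close> does not clip its parameter
  when \<open>P\<close> takes values in \<open>[0,1]\<close>.
\<close>

definition stage_pmf :: "(nat \<Rightarrow> nat \<Rightarrow> real) \<Rightarrow> nat \<Rightarrow> nat \<Rightarrow> nat \<Rightarrow> nat pmf" where
  "stage_pmf P a b x = map_pmf (\<lambda>w. if w then x + b else x - a) (bernoulli_pmf (P a b))"

text \<open>
  Conditional law of the fortune of player I at index \<open>i\<close> given the earlier ones. Indices of
  trajectories start at \<open>0\<close>, so that \<open>\<omega> i\<close> is the value of \<open>X\<^sub>i\<^sub>+\<^sub>1\<close>.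
\<close>

definition fortune_kernel ::
  "(nat \<Rightarrow> nat \<Rightarrow> real) \<Rightarrow> nat \<Rightarrow> strategy \<Rightarrow> strategy \<Rightarrow> nat \<Rightarrow> (nat \<Rightarrow> nat) \<Rightarrow> nat measure" where
  "fortune_kernel P x0 \<sigma> \<tau> i \<omega> =
     measure_pmf (if i = 0 then return_pmf x0
                  else let h = map \<omega> [0..<i] in stage_pmf P (\<sigma> h) (\<tau> h) (last h))"

text \<open>
  The law on infinite trajectories with these conditional laws; the lemmas
  \<open>Ionescu_Tulcea_fortune_kernel\<close>, \<open>game_start\<close> and \<open>game_step\<close> below confirm that it is the
  intended one.
\<close>

definition game_measure ::
  "(nat \<Rightarrow> nat \<Rightarrow> real) \<Rightarrow> nat \<Rightarrow> strategy \<Rightarrow> strategy \<Rightarrow> (nat \<Rightarrow> nat) measure" where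
  "game_measure P x0 \<sigma> \<tau> =
     projective_family.lim UNIV
       (Ionescu_Tulcea.CI (fortune_kernel P x0 \<sigma> \<tau>) (\<lambda>_. count_space UNIV))
       (\<lambda>_. count_space UNIV)"

definition win_I ::
  "nat \<Rightarrow> (nat \<Rightarrow> nat \<Rightarrow> real) \<Rightarrow> nat \<Rightarrow> strategy \<Rightarrow> strategy \<Rightarrow> real" where
  "win_I M P x0 \<sigma> \<tau> =
     measure (game_measure P x0 \<sigma> \<tau>)
       {\<omega> \<in> space (game_measure P x0 \<sigma> \<tau>). \<exists>m. \<omega> m = M}"

definition win_II ::
  "nat \<Rightarrow> (nat \<Rightarrow> nat \<Rightarrow> real) \<Rightarrow> nat \<Rightarrow> strategy \<Rightarrow> strategy \<Rightarrow> real" where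
  "win_II M P x0 \<sigma> \<tau> =
     measure (game_measure P x0 \<sigma> \<tau>)
       {\<omega> \<in> space (game_measure P x0 \<sigma> \<tau>). \<exists>m. M - \<omega> m = M}"

definition nash_equilibrium ::
  "nat \<Rightarrow> (nat \<Rightarrow> nat \<Rightarrow> real) \<Rightarrow> nat \<Rightarrow> strategy \<Rightarrow> strategy \<Rightarrow> bool" where
  "nash_equilibrium M P x0 \<sigma> \<tau> \<longleftrightarrow>
     \<sigma> \<in> strategies_I M \<and> \<tau> \<in> strategies_II M \<and>
     (\<forall>\<sigma>'\<in>strategies_I M. win_I M P x0 \<sigma>' \<tau> \<le> win_I M P x0 \<sigma> \<tau>) \<and>
     (\<forall>\<tau>'\<in>strategies_II M. win_II M P x0 \<sigma> \<tau>' \<le> win_II M P x0 \<sigma> \<tau>)"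

lemma bold_I_strategy: "bold_I \<in> strategies_I M"
  by (auto simp: strategies_I_def bold_I_def admissible_bids_def)

lemma timid_II_strategy: "timid_II M \<in> strategies_II M"
  by (auto simp: strategies_II_def timid_II_def admissible_bids_def)

lemma measurable_history:
  "(\<lambda>\<omega>. map \<omega> [0..<i]) \<in> measurable (PiM {0..<i} (\<lambda>_. count_space (UNIV :: nat set))) (count_space UNIV)"
proof -
  have *: "(\<lambda>\<omega>. map \<omega> js) \<in> measurable (PiM I (\<lambda>_. count_space (UNIV :: nat set))) (count_space UNIV)"
    if "set js \<subseteq> I" for js :: "nat list" and I
    using that
  proof (induction js)
    case Nil
    then show ?case by simp
  next
    case (Cons j js)
    have "(\<lambda>\<omega>. (\<omega> j, map \<omega> js)) \<in> measurable (PiM I (\<lambda>_. count_space (UNIV :: nat set)))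
        (count_space UNIV \<Otimes>\<^sub>M count_space UNIV)"
      using Cons by (intro measurable_Pair) auto
    then have "(\<lambda>p. fst p # snd p) \<circ> (\<lambda>\<omega>. (\<omega> j, map \<omega> js)) \<in>
        measurable (PiM I (\<lambda>_. count_space (UNIV :: nat set))) (count_space UNIV)"
      by (rule measurable_comp) (simp add: pair_measure_countable)
    then show ?case by (simp add: comp_def)
  qed
  show ?thesis by (rule *) auto
qed

lemma Ionescu_Tulcea_fortune_kernel:
  "Ionescu_Tulcea (fortune_kernel P x0 \<sigma> \<tau>) (\<lambda>_. count_space UNIV)"
proof (rule Ionescu_Tulcea.intro)
  fix i :: nat
  let ?K = "\<lambda>h. measure_pmf (if i = 0 then return_pmf x0 else stage_pmf P (\<sigma> h) (\<tau> h) (last h))"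
  have "?K \<in> measurable (count_space UNIV) (subprob_algebra (count_space UNIV))"
    by (simp add: measure_pmf_in_subprob_algebra)
  from measurable_comp[OF measurable_history this, of i]
  show "fortune_kernel P x0 \<sigma> \<tau> i \<in>
      measurable (PiM {0..<i} (\<lambda>_. count_space UNIV)) (subprob_algebra (count_space UNIV))"
    unfolding fortune_kernel_def[abs_def] Let_def comp_def .
next
  fix i :: nat and \<omega> :: "nat \<Rightarrow> nat"
  show "prob_space (fortune_kernel P x0 \<sigma> \<tau> i \<omega>)"
    by (simp add: fortune_kernel_def measure_pmf.prob_space_axioms)
qed

lemma space_game_measure [simp]: "space (game_measure P x0 \<sigma> \<tau>) = UNIV"
proof -
  interpret Ionescu_Tulcea "fortune_kernel P x0 \<sigma> \<tau>" "\<lambda>_. count_space UNIV"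
    by (rule Ionescu_Tulcea_fortune_kernel)
  show ?thesis by (simp add: game_measure_def space_PiM)
qed

lemma sets_game_measure [measurable_cong]:
  "sets (game_measure P x0 \<sigma> \<tau>) = sets (PiM UNIV (\<lambda>_. count_space UNIV))"
proof -
  interpret Ionescu_Tulcea "fortune_kernel P x0 \<sigma> \<tau>" "\<lambda>_. count_space UNIV"
    by (rule Ionescu_Tulcea_fortune_kernel)
  show ?thesis by (simp add: game_measure_def)
qed

text \<open>Laws of initial segments of the trajectory.\<close>

lemma emeasure_game_prefix:
  "emeasure (game_measure P x0 \<sigma> \<tau>) {\<omega>. map \<omega> [0..<n] = h} =
     emeasure (Ionescu_Tulcea.C (fortune_kernel P x0 \<sigma> \<tau>) (\<lambda>_. count_space UNIV) 0 n (\<lambda>_. undefined))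
       {\<omega> \<in> space (PiM {0..<n} (\<lambda>_. count_space UNIV)). map \<omega> [0..<n] = h}"
proof -
  interpret Ionescu_Tulcea "fortune_kernel P x0 \<sigma> \<tau>" "\<lambda>_. count_space UNIV"
    by (rule Ionescu_Tulcea_fortune_kernel)
  let ?N = "\<lambda>_ :: nat. count_space UNIV :: nat measure"
  let ?X = "{\<omega> \<in> space (PiM {0..<n} ?N). map \<omega> [0..<n] = h}"
  have X: "?X \<in> sets (PiM {0..<n} ?N)"
    using measurable_sets[OF measurable_history, of "{h}" n] by (simp add: vimage_def Int_def conj_commute)
  have emb: "prod_emb {0..<n} ?N {0..<n} ?X = ?X"
    by (rule prod_emb_id) (auto simp: space_PiM)
  have "{\<omega>. map \<omega> [0..<n] = h} = prod_emb UNIV ?N {0..<n} ?X"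
    by (auto simp: prod_emb_def space_PiM cong: map_cong)
  then have "emeasure (game_measure P x0 \<sigma> \<tau>) {\<omega>. map \<omega> [0..<n] = h} = emeasure (CI {0..<n}) ?X"
    using lim[OF _ X] by (simp add: game_measure_def)
  also have "\<dots> = emeasure (C 0 n (\<lambda>_. undefined)) ?X"
    using emeasure_CI[OF subset_refl X] by (simp only: emb)
  finally show ?thesis .
qed

lemma emeasure_game_prefix_Suc:
  assumes "length h = n"
  shows "emeasure (game_measure P x0 \<sigma> \<tau>) {\<omega>. map \<omega> [0..<Suc n] = h @ [z]} =
     emeasure (game_measure P x0 \<sigma> \<tau>) {\<omega>. map \<omega> [0..<n] = h} *
     ennreal (pmf (if n = 0 then return_pmf x0 else stage_pmf P (\<sigma> h) (\<tau> h) (last h)) z)"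
proof -
  interpret Ionescu_Tulcea "fortune_kernel P x0 \<sigma> \<tau>" "\<lambda>_. count_space UNIV"
    by (rule Ionescu_Tulcea_fortune_kernel)
  let ?N = "\<lambda>_ :: nat. count_space UNIV :: nat measure"
  let ?X = "\<lambda>n h. {\<omega> \<in> space (PiM {0..<n} ?N). map \<omega> [0..<n] = h}"
  let ?u = "\<lambda>_ :: nat. undefined :: nat"
  let ?p = "ennreal (pmf (if n = 0 then return_pmf x0 else stage_pmf P (\<sigma> h) (\<tau> h) (last h)) z)"
  have X: "?X n h \<in> sets (PiM {0..<n} ?N)" for n h
    using measurable_sets[OF measurable_history, of "{h}" n] by (simp add: vimage_def Int_def conj_commute)
  have u: "?u \<in> space (PiM {0..<0} ?N)" by simp
  have sp: "space (C 0 n ?u) = space (PiM {0..<n} ?N)" using space_C[OF u, of n] by simp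
  have st: "sets (C 0 n ?u) = sets (PiM {0..<n} ?N)" using sets_C[OF u, of n] by simp
  have 1: "emeasure (eP n \<omega>) (?X (Suc n) (h @ [z])) = ?p * indicator (?X n h) \<omega>"
    if \<omega>: "\<omega> \<in> space (PiM {0..<n} ?N)" for \<omega>
  proof -
    have "(\<lambda>x. fun_upd \<omega> n x) -` ?X (Suc n) (h @ [z]) = (if map \<omega> [0..<n] = h then {z} else {})"
      using \<omega> by (auto simp: space_PiM PiE_iff extensional_def cong: map_cong)
    then show ?thesis
      using \<omega> by (subst emeasure_eP[OF \<omega> X])
        (auto simp: fortune_kernel_def Let_def emeasure_pmf_single indicator_def)
  qed
  have "emeasure (C 0 (Suc n) ?u) (?X (Suc n) (h @ [z])) =
      (\<integral>\<^sup>+\<omega>. emeasure (eP n \<omega>) (?X (Suc n) (h @ [z])) \<partial>C 0 n ?u)"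
    using measurable_eP[of n] st sp X
    by (simp del: upt_Suc, subst emeasure_bind[where N = "PiM {0..<Suc n} ?N"])
       (auto cong: measurable_cong_sets simp: space_PiM simp del: upt_Suc)
  also have "\<dots> = (\<integral>\<^sup>+\<omega>. ?p * indicator (?X n h) \<omega> \<partial>C 0 n ?u)"
    by (rule nn_integral_cong) (simp only: 1 sp)
  also have "\<dots> = ?p * emeasure (C 0 n ?u) (?X n h)"
    using X st by (subst nn_integral_cmult_indicator) simp_all
  finally show ?thesis
    unfolding emeasure_game_prefix by (simp only: mult.commute)
qed

lemma prob_space_game_measure: "prob_space (game_measure P x0 \<sigma> \<tau>)"
proof -
  interpret Ionescu_Tulcea "fortune_kernel P x0 \<sigma> \<tau>" "\<lambda>_. count_space UNIV"
    by (rule Ionescu_Tulcea_fortune_kernel)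
  have "emeasure (game_measure P x0 \<sigma> \<tau>) {\<omega>. map \<omega> [0..<0] = []} = 1"
    by (subst emeasure_game_prefix) (simp add: space_PiM sets_PiM_empty)
  then show ?thesis by (intro prob_spaceI) simp
qed

lemma game_start: "measure (game_measure P x0 \<sigma> \<tau>) {\<omega>. \<omega> 0 = x0} = 1"
proof -
  interpret prob_space "game_measure P x0 \<sigma> \<tau>" by (rule prob_space_game_measure)
  show ?thesis
    using emeasure_game_prefix_Suc[of "[]" 0 P x0 \<sigma> \<tau> x0] emeasure_space_1
    by (simp add: measure_def)
qed

lemma game_step:
  assumes "h \<noteq> []"
  shows "measure (game_measure P x0 \<sigma> \<tau>) {\<omega>. map \<omega> [0..<Suc (length h)] = h @ [z]} =
     measure (game_measure P x0 \<sigma> \<tau>) {\<omega>. map \<omega> [0..<length h] = h} *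
     pmf (stage_pmf P (\<sigma> h) (\<tau> h) (last h)) z"
  using emeasure_game_prefix_Suc[OF refl, of P x0 \<sigma> \<tau> h z] assms
  by (simp add: measure_def enn2real_mult del: upt_Suc)

end

theory Submission
  imports Defs
begin

text \<open>
  Let \<open>Q x = (\<Prod>k=x..<M. P k 1)\<close>, the probability that player I wins from fortune \<open>x\<close> in the
  bold-timid game. Against timid play \<open>Q\<close> is superharmonic for every bid of player I, by the
  condition on \<open>P \<cdot> 1\<close>; against bold play \<open>1 - Q\<close> is superharmonic for every bid of player II, by the
  condition on \<open>P x a * P (x + a) b\<close>. For a superharmonic function, the probability of hitting a
  state where it equals \<open>1\<close> is at most its initial value. This bounds all deviations, and the
  bold-timid profile attains both bounds, as it ends the game within \<open>M\<close> stages.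
\<close>

section \<open>Discrete laws of finite histories\<close>

text \<open>Stage \<open>n\<close> carries lists of length \<open>n + 1\<close>, hence the prefixes
  \<open>[0..<Suc n]\<close> below. With a discrete law, one stage of play is a single
  \<open>bind_pmf\<close>.\<close>

primrec history_pmf :: "(nat \<Rightarrow> nat \<Rightarrow> real) \<Rightarrow> nat \<Rightarrow> strategy \<Rightarrow> strategy \<Rightarrow> nat \<Rightarrow> nat list pmf" where
  "history_pmf P x0 \<sigma> \<tau> 0 = return_pmf [x0]"
| "history_pmf P x0 \<sigma> \<tau> (Suc n) =
     bind_pmf (history_pmf P x0 \<sigma> \<tau> n)
       (\<lambda>h. map_pmf (\<lambda>z. h @ [z]) (stage_pmf P (\<sigma> h) (\<tau> h) (last h)))"

lemma length_history_pmf: "h \<in> set_pmf (history_pmf P x0 \<sigma> \<tau> n) \<Longrightarrow> length h = Suc n"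
  by (induction n arbitrary: h) auto

lemma set_stage_pmf: "set_pmf (stage_pmf P a b x) \<subseteq> {x + b, x - a}"
  by (auto simp: stage_pmf_def)

text \<open>A list decomposes uniquely into its initial part and last entry, so only the summand
  \<open>h' = h\<close> of the bind contributes. This is the recursion that
  \<open>emeasure_game_prefix_Suc\<close> gives for the game measure.\<close>

lemma pmf_history_pmf_Suc_snoc:
  "ennreal (pmf (history_pmf P x0 \<sigma> \<tau> (Suc n)) (h @ [z])) =
     ennreal (pmf (history_pmf P x0 \<sigma> \<tau> n) h) * ennreal (pmf (stage_pmf P (\<sigma> h) (\<tau> h) (last h)) z)"
proof -
  let ?S = "\<lambda>h. stage_pmf P (\<sigma> h) (\<tau> h) (last h)"
  have *: "pmf (map_pmf (\<lambda>z. h' @ [z]) (?S h')) (h @ [z]) = pmf (?S h) z * indicator {h} h'" for h'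
  proof (cases "h' = h")
    case True
    have "inj (\<lambda>z. h @ [z])" by (auto simp: inj_on_def)
    from pmf_map_inj'[OF this, of "?S h" z] True show ?thesis by simp
  next
    case False
    then show ?thesis by (auto simp: pmf_eq_0_set_pmf)
  qed
  show ?thesis
    by (simp add: ennreal_pmf_bind * ennreal_mult' ennreal_indicator nn_integral_multc
        emeasure_pmf_single mult.commute[of _ "indicator _ _"])
qed

text \<open>Both sides start at \<open>x0\<close> and obey the same one-stage recursion; lists of
  the wrong length are null for both.\<close>

lemma emeasure_game_prefix_eq_pmf:
  "emeasure (game_measure P x0 \<sigma> \<tau>) {\<omega>. map \<omega> [0..<Suc n] = h} = pmf (history_pmf P x0 \<sigma> \<tau> n) h"
proof (induction n arbitrary: h)
  case 0
  interpret prob_space "game_measure P x0 \<sigma> \<tau>" by (rule prob_space_game_measure)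
  show ?case
  proof (cases h rule: rev_cases)
    case (snoc h' z)
    show ?thesis
    proof (cases "h' = []")
      case True
      with snoc show ?thesis
        using emeasure_game_prefix_Suc[of "[]" 0 P x0 \<sigma> \<tau> z] emeasure_space_1
        by (auto simp: indicator_def)
    next
      case False
      with snoc show ?thesis by (auto simp: indicator_def)
    qed
  qed simp
next
  case (Suc n)
  show ?case
  proof (cases h rule: rev_cases)
    case Nil
    have "[] \<notin> set_pmf (history_pmf P x0 \<sigma> \<tau> (Suc n))"
      using length_history_pmf by fastforce
    with Nil show ?thesis by (simp add: pmf_eq_0_set_pmf)
  next
    case (snoc h' z)
    show ?thesis
    proof (cases "length h' = Suc n")
      case True
      show ?thesis
        unfolding snoc emeasure_game_prefix_Suc[OF True] Suc.IH pmf_history_pmf_Suc_snoc by simp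
    next
      case False
      then have "{\<omega>. map \<omega> [0..<Suc (Suc n)] = h' @ [z]} = {}" by auto
      moreover have "h \<notin> set_pmf (history_pmf P x0 \<sigma> \<tau> (Suc n))"
        using length_history_pmf[of h P x0 \<sigma> \<tau> "Suc n"] False snoc by auto
      ultimately show ?thesis using snoc by (simp add: pmf_eq_0_set_pmf del: upt_Suc history_pmf.simps)
    qed
  qed
qed

lemma measurable_prefix [measurable]:
  "(\<lambda>\<omega>. map \<omega> [0..<n]) \<in> measurable (game_measure P x0 \<sigma> \<tau>) (count_space UNIV)"
proof -
  have "(\<lambda>\<omega>. restrict \<omega> {0..<n}) \<in>
      measurable (PiM UNIV (\<lambda>_. count_space UNIV)) (PiM {0..<n} (\<lambda>_. count_space (UNIV :: nat set)))"
    by (rule measurable_restrict_subset) simp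
  from measurable_comp[OF this measurable_history]
  have "(\<lambda>\<omega>. map (restrict \<omega> {0..<n}) [0..<n]) \<in>
      measurable (PiM UNIV (\<lambda>_. count_space (UNIV :: nat set))) (count_space UNIV)"
    by (simp add: comp_def)
  moreover have "map (restrict \<omega> {0..<n}) [0..<n] = map \<omega> [0..<n]" for \<omega> :: "nat \<Rightarrow> nat"
    by simp
  ultimately show ?thesis
    by (simp add: measurable_cong_sets[OF sets_game_measure refl] del: map_eq_conv)
qed

lemma distr_game_prefix:
  "distr (game_measure P x0 \<sigma> \<tau>) (count_space UNIV) (\<lambda>\<omega>. map \<omega> [0..<Suc n]) =
     measure_pmf (history_pmf P x0 \<sigma> \<tau> n)"
proof (rule measure_eqI_countable[where A = UNIV])
  fix h :: "nat list"
  show "emeasure (distr (game_measure P x0 \<sigma> \<tau>) (count_space UNIV) (\<lambda>\<omega>. map \<omega> [0..<Suc n])) {h} =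
      emeasure (measure_pmf (history_pmf P x0 \<sigma> \<tau> n)) {h}"
    using emeasure_game_prefix_eq_pmf[of P x0 \<sigma> \<tau> n h]
    by (subst emeasure_distr) (simp_all add: emeasure_pmf_single vimage_def del: upt_Suc)
qed simp_all

section \<open>Hitting probabilities as limits over finite horizons\<close>

lemma hits_before_eq_vimage:
  "{\<omega>. \<exists>m\<le>n. \<omega> m = t} = (\<lambda>\<omega>. map \<omega> [0..<Suc n]) -` {h. t \<in> set h}"
  by (auto simp: image_iff Bex_def less_Suc_eq_le simp del: upt_Suc)

lemma emeasure_game_hits_before:
  "emeasure (game_measure P x0 \<sigma> \<tau>) {\<omega>. \<exists>m\<le>n. \<omega> m = t} =
     emeasure (measure_pmf (history_pmf P x0 \<sigma> \<tau> n)) {h. t \<in> set h}"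
  unfolding hits_before_eq_vimage
  by (simp add: distr_game_prefix[symmetric] emeasure_distr del: upt_Suc)

lemma sets_game_hits_before: "{\<omega>. \<exists>m\<le>n. \<omega> m = t} \<in> sets (game_measure P x0 \<sigma> \<tau>)"
  unfolding hits_before_eq_vimage
  using measurable_sets[OF measurable_prefix, of "{h. t \<in> set h}" "Suc n"] by (simp del: upt_Suc)

text \<open>Continuity from below: the events of a visit by time \<open>n\<close> increase to the
  event of a visit at any time.\<close>

lemma emeasure_game_hits:
  "emeasure (game_measure P x0 \<sigma> \<tau>) {\<omega>. \<exists>m. \<omega> m = t} =
     (SUP n. emeasure (measure_pmf (history_pmf P x0 \<sigma> \<tau> n)) {h. t \<in> set h})"
proof -
  have "{\<omega> :: nat \<Rightarrow> nat. \<exists>m. \<omega> m = t} = (\<Union>n. {\<omega>. \<exists>m\<le>n. \<omega> m = t})" by auto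
  moreover have "incseq (\<lambda>n. {\<omega> :: nat \<Rightarrow> nat. \<exists>m\<le>n. \<omega> m = t})"
    by (auto simp: incseq_def intro: order_trans)
  moreover have "range (\<lambda>n. {\<omega>. \<exists>m\<le>n. \<omega> m = t}) \<subseteq> sets (game_measure P x0 \<sigma> \<tau>)"
    using sets_game_hits_before by blast
  ultimately show ?thesis
    using SUP_emeasure_incseq[of "\<lambda>n. {\<omega>. \<exists>m\<le>n. \<omega> m = t}" "game_measure P x0 \<sigma> \<tau>"]
    by (simp add: emeasure_game_hits_before)
qed

section \<open>Super- and subharmonic bounds on hitting probabilities\<close>

lemma last_history_le: "h \<in> histories M \<Longrightarrow> last h \<le> M"
  using last_in_set by (fastforce simp: histories_def)

lemma set_history_pmf:
  assumes "\<sigma> \<in> strategies_I M" "\<tau> \<in> strategies_II M" "x0 \<le> M"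
  shows "set_pmf (history_pmf P x0 \<sigma> \<tau> n) \<subseteq> histories M"
proof (induction n)
  case 0
  then show ?case using assms by (simp add: histories_def)
next
  case (Suc n)
  show ?case
  proof
    fix k assume "k \<in> set_pmf (history_pmf P x0 \<sigma> \<tau> (Suc n))"
    then obtain h z where h: "h \<in> set_pmf (history_pmf P x0 \<sigma> \<tau> n)" and k: "k = h @ [z]"
      and z: "z \<in> set_pmf (stage_pmf P (\<sigma> h) (\<tau> h) (last h))" by auto
    from h Suc have hM: "h \<in> histories M" by auto
    then have "last h \<le> M" "\<tau> h \<le> M - last h"
      using assms last_history_le by (auto simp: strategies_II_def admissible_bids_def)
    then have "z \<le> M" using z set_stage_pmf[of P "\<sigma> h" "\<tau> h" "last h"] by auto
    then show "k \<in> histories M" using hM k by (auto simp: histories_def)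
  qed
qed

lemma nn_integral_stage_pmf:
  assumes "P a b \<in> {0..1}" "0 \<le> f (x + b)" "0 \<le> f (x - a)"
  shows "(\<integral>\<^sup>+z. ennreal (f z) \<partial>stage_pmf P a b x) = ennreal (P a b * f (x + b) + (1 - P a b) * f (x - a))"
  using assms by (simp add: stage_pmf_def ennreal_plus ennreal_mult mult.commute)

text \<open>
  Replacing \<open>f (last h)\<close> by \<open>1\<close> once the target \<open>t\<close> has been visited makes the hitting probability
  accessible without using that \<open>t\<close> is absorbing.
\<close>

definition hit_value :: "nat \<Rightarrow> (nat \<Rightarrow> real) \<Rightarrow> nat list \<Rightarrow> real" where
  "hit_value t f h = (if t \<in> set h then 1 else f (last h))"

text \<open>Both strategies are arbitrary, so that the bounds apply to deviations of either player
  and to the bold-timid pair itself.\<close>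

locale game =
  fixes M x0 :: nat and P :: "nat \<Rightarrow> nat \<Rightarrow> real" and \<sigma> \<tau> :: strategy
  assumes x0: "x0 \<le> M"
    and P: "a \<le> M \<Longrightarrow> b \<le> M \<Longrightarrow> P a b \<in> {0..1}"
    and \<sigma>: "\<sigma> \<in> strategies_I M" and \<tau>: "\<tau> \<in> strategies_II M"
begin

abbreviation hist where "hist \<equiv> history_pmf P x0 \<sigma> \<tau>"

lemma bids:
  assumes "h \<in> histories M"
  shows "\<sigma> h \<in> admissible_bids (last h)" "\<tau> h \<in> admissible_bids (M - last h)" "last h \<le> M"
  using assms \<sigma> \<tau> last_history_le by (auto simp: strategies_I_def strategies_II_def)

abbreviation stage_mean :: "(nat \<Rightarrow> real) \<Rightarrow> nat list \<Rightarrow> real" where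
  "stage_mean f h \<equiv>
     P (\<sigma> h) (\<tau> h) * f (last h + \<tau> h) + (1 - P (\<sigma> h) (\<tau> h)) * f (last h - \<sigma> h)"

text \<open>Before the first visit to \<open>t\<close>, appending \<open>z\<close> gives
  \<open>f z\<close> even for \<open>z = t\<close>, because \<open>f t = 1\<close>; after it the
  value is frozen at \<open>1\<close>.\<close>

lemma nn_integral_hit_value_snoc:
  assumes h: "h \<in> histories M" and f: "\<And>x. x \<le> M \<Longrightarrow> 0 \<le> f x" and t: "f t = 1"
  shows "(\<integral>\<^sup>+z. ennreal (hit_value t f (h @ [z])) \<partial>stage_pmf P (\<sigma> h) (\<tau> h) (last h)) =
    ennreal (if t \<in> set h then 1 else stage_mean f h)"
proof (cases "t \<in> set h")
  case True
  then show ?thesis by (simp add: hit_value_def)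
next
  case False
  then have "hit_value t f (h @ [z]) = f z" for z using t by (auto simp: hit_value_def)
  moreover from bids[OF h] have "\<sigma> h \<le> last h" "\<tau> h \<le> M - last h" "last h \<le> M"
    by (auto simp: admissible_bids_def)
  ultimately show ?thesis using False f P by (simp add: nn_integral_stage_pmf)
qed

text \<open>Superharmonicity makes the mean of \<open>hit_value t f\<close> nonincreasing in
  \<open>n\<close>, starting from \<open>f x0\<close>, and \<open>hit_value t f\<close> dominates
  the indicator of a visit.\<close>

lemma emeasure_hist_hits_le:
  assumes f: "\<And>x. x \<le> M \<Longrightarrow> 0 \<le> f x" and t: "f t = 1"
    and super: "\<And>h. h \<in> histories M \<Longrightarrow> stage_mean f h \<le> f (last h)"
  shows "emeasure (measure_pmf (hist n)) {h. t \<in> set h} \<le> ennreal (f x0)"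
proof -
  have "(\<integral>\<^sup>+h. ennreal (hit_value t f h) \<partial>hist n) \<le> ennreal (f x0)"
  proof (induction n)
    case 0
    then show ?case using f[OF x0] t by (auto simp: hit_value_def)
  next
    case (Suc n)
    have "(\<integral>\<^sup>+h. ennreal (hit_value t f h) \<partial>hist (Suc n)) =
        (\<integral>\<^sup>+h. \<integral>\<^sup>+z. ennreal (hit_value t f (h @ [z])) \<partial>stage_pmf P (\<sigma> h) (\<tau> h) (last h) \<partial>hist n)"
      by simp
    also have "\<dots> \<le> (\<integral>\<^sup>+h. ennreal (hit_value t f h) \<partial>hist n)"
    proof (intro nn_integral_mono_AE AE_pmfI)
      fix h assume "h \<in> set_pmf (hist n)"
      then have h: "h \<in> histories M" using set_history_pmf[OF \<sigma> \<tau> x0] by auto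
      show "(\<integral>\<^sup>+z. ennreal (hit_value t f (h @ [z])) \<partial>stage_pmf P (\<sigma> h) (\<tau> h) (last h)) \<le>
          ennreal (hit_value t f h)"
        using super[OF h] by (subst nn_integral_hit_value_snoc[where f = f and t = t, OF h f t])
          (auto simp: hit_value_def intro: ennreal_leI)
    qed
    finally show ?case using Suc.IH by (rule order_trans)
  qed
  moreover have "emeasure (measure_pmf (hist n)) {h. t \<in> set h} \<le> (\<integral>\<^sup>+h. ennreal (hit_value t f h) \<partial>hist n)"
  proof -
    have "(\<integral>\<^sup>+h. indicator {h. t \<in> set h} h \<partial>hist n) \<le> (\<integral>\<^sup>+h. ennreal (hit_value t f h) \<partial>hist n)"
      by (intro nn_integral_mono) (simp add: hit_value_def indicator_def)
    then show ?thesis by simp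
  qed
  ultimately show ?thesis by (rule order_trans[rotated])
qed

lemma measure_game_hits_le:
  assumes f: "\<And>x. x \<le> M \<Longrightarrow> 0 \<le> f x" and t: "f t = 1"
    and super: "\<And>h. h \<in> histories M \<Longrightarrow> stage_mean f h \<le> f (last h)"
  shows "measure (game_measure P x0 \<sigma> \<tau>) {\<omega>. \<exists>m. \<omega> m = t} \<le> f x0"
proof -
  have "emeasure (game_measure P x0 \<sigma> \<tau>) {\<omega>. \<exists>m. \<omega> m = t} \<le> ennreal (f x0)"
    unfolding emeasure_game_hits by (intro SUP_least emeasure_hist_hits_le assms)
  then show ?thesis using f[OF x0] by (simp add: measure_def enn2real_leI)
qed

text \<open>Dually, the mean of \<open>hit_value t f\<close> never falls below \<open>f x0\<close>.
  By \<open>stop\<close>, at time \<open>n\<close> it is bounded by the indicator of a visit to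
  \<open>t\<close>.\<close>

lemma measure_game_hits_ge:
  assumes f: "\<And>x. x \<le> M \<Longrightarrow> f x \<in> {0..1}" and t: "f t = 1"
    and sub: "\<And>h. h \<in> histories M \<Longrightarrow> f (last h) \<le> stage_mean f h"
    and stop: "\<And>h. h \<in> set_pmf (hist n) \<Longrightarrow> last h = t \<or> f (last h) = 0"
  shows "f x0 \<le> measure (game_measure P x0 \<sigma> \<tau>) {\<omega>. \<exists>m. \<omega> m = t}"
proof -
  interpret prob_space "game_measure P x0 \<sigma> \<tau>" by (rule prob_space_game_measure)
  have f0: "0 \<le> f x" if "x \<le> M" for x using f[OF that] by simp
  have "ennreal (f x0) \<le> (\<integral>\<^sup>+h. ennreal (hit_value t f h) \<partial>hist k)" for k
  proof (induction k)
    case 0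
    then show ?case using f[OF x0] t by (auto simp: hit_value_def)
  next
    case (Suc k)
    have "(\<integral>\<^sup>+h. ennreal (hit_value t f h) \<partial>hist k) \<le>
        (\<integral>\<^sup>+h. \<integral>\<^sup>+z. ennreal (hit_value t f (h @ [z])) \<partial>stage_pmf P (\<sigma> h) (\<tau> h) (last h) \<partial>hist k)"
    proof (intro nn_integral_mono_AE AE_pmfI)
      fix h assume "h \<in> set_pmf (hist k)"
      then have h: "h \<in> histories M" using set_history_pmf[OF \<sigma> \<tau> x0] by auto
      show "ennreal (hit_value t f h) \<le>
          (\<integral>\<^sup>+z. ennreal (hit_value t f (h @ [z])) \<partial>stage_pmf P (\<sigma> h) (\<tau> h) (last h))"
        using sub[OF h] by (subst nn_integral_hit_value_snoc[where f = f and t = t, OF h f0 t])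
          (auto simp: hit_value_def intro: ennreal_leI)
    qed
    with Suc.IH show ?case by simp
  qed
  also have "(\<integral>\<^sup>+h. ennreal (hit_value t f h) \<partial>hist n) \<le> (\<integral>\<^sup>+h. indicator {h. t \<in> set h} h \<partial>hist n)"
  proof (intro nn_integral_mono_AE AE_pmfI)
    fix h assume h: "h \<in> set_pmf (hist n)"
    then have "h \<noteq> []" using length_history_pmf by fastforce
    then show "ennreal (hit_value t f h) \<le> indicator {h. t \<in> set h} h"
      using stop[OF h] by (auto simp: hit_value_def indicator_def)
  qed
  also have "\<dots> \<le> emeasure (game_measure P x0 \<sigma> \<tau>) {\<omega>. \<exists>m. \<omega> m = t}"
    unfolding emeasure_game_hits by (auto intro: SUP_upper)
  finally show ?thesis by (simp add: emeasure_eq_measure)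
qed

end

section \<open>The bold-timid game and its deviations\<close>

text \<open>From an interior state player I either drops to \<open>0\<close> or gains exactly one
  unit, so surviving \<open>n\<close> stages means having at least \<open>x0 + n\<close>. Both
  outcomes from \<open>M\<close> lie in \<open>{0, M}\<close>, and \<open>P 0 1 = 0\<close> keeps
  \<open>0\<close> fixed.\<close>

lemma bold_timid_ends:
  assumes "0 < x0" "x0 \<le> M" "P 0 1 = 0" "h \<in> set_pmf (history_pmf P x0 bold_I (timid_II M) n)"
  shows "last h = 0 \<or> last h = M \<or> n < last h"
  using assms(4)
proof (induction n arbitrary: h)
  case 0
  then show ?case using assms by simp
next
  case (Suc n)
  then obtain k z where k: "k \<in> set_pmf (history_pmf P x0 bold_I (timid_II M) n)" and h: "h = k @ [z]"
    and z: "z \<in> set_pmf (stage_pmf P (bold_I k) (timid_II M k) (last k))" by auto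
  have "last k \<le> M"
    using set_history_pmf[OF bold_I_strategy timid_II_strategy assms(2)] k last_history_le
    by blast
  moreover have "True \<notin> set_pmf (bernoulli_pmf 0)" by (simp add: set_pmf_iff)
  ultimately show ?case
    using Suc.IH[OF k] h z assms
    by (cases "last k = 0")
       (auto simp: stage_pmf_def bold_I_def timid_II_def split: if_splits)
qed

theorem corollary1:
  fixes M x0 y0 :: nat and P :: "nat \<Rightarrow> nat \<Rightarrow> real"
  assumes "M \<ge> 2"
    and "0 < x0" and "0 < y0" and "x0 + y0 = M"
    and "\<And>a b. a \<in> {0..M} \<Longrightarrow> b \<in> {0..M} \<Longrightarrow> P a b \<in> {0..1}"
    and "\<And>a. a \<in> {0..M} - {0} \<Longrightarrow> P a 0 = 1"
    and "\<And>b. b \<in> {0..M} - {0} \<Longrightarrow> P 0 b = 0"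
    and "\<And>x a b. x \<in> {0..M} \<Longrightarrow> a \<in> {0..M - x} \<Longrightarrow> b \<in> {0..M - a} \<Longrightarrow>
           P x a * P (x + a) b \<le> P x (a + b)"
    and "mono_on {0..M} (\<lambda>x. P x 1)"
    and "\<And>x y. x \<in> {0..M} \<Longrightarrow> y \<in> {0..M} \<Longrightarrow> y \<le> x \<Longrightarrow>
           P y 1 - P x 1 \<le> P (x - y) 1 * (P y 1 - 1)"
  shows "nash_equilibrium M P x0 bold_I (timid_II M)"
proof -
  note P01 = assms(5) and P_0 = assms(6) and P_absorb = assms(7) and P_mult = assms(8)
    and phi = assms(10)
  define Q where "Q x = (\<Prod>k=x..<M. P k 1)" for x
  have x0M: "x0 \<le> M" and M: "0 < M" using assms(1,4) by auto
  have P: "P a b \<in> {0..1}" if "a \<le> M" "b \<le> M" for a b using P01 that by simp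
  have P1: "0 \<le> P k 1" "P k 1 \<le> 1" if "k \<le> M" for k using P[OF that, of 1] M by auto
  have P01_0: "P 0 1 = 0" using P_absorb[of 1] M by simp
  have QM: "Q M = 1" by (simp add: Q_def)
  have Q_step: "Q x = P x 1 * Q (Suc x)" if "x < M" for x
    using that by (simp add: Q_def prod.atLeast_Suc_lessThan)
  have Q0: "Q 0 = 0" using Q_step[OF M] P01_0 by simp
  have Q01: "0 \<le> Q x" "Q x \<le> 1" for x
    unfolding Q_def by (intro prod_nonneg prod_le_1 ballI conjI P1; simp)+
  \<comment> \<open>\<open>Q\<close> is nondecreasing, as its factors are at most \<open>1\<close>.
    For \<open>y = x - a\<close> this bounds the value after a lost bid by a multiple of
    \<open>Q (Suc x)\<close>, the value after a won bid.\<close>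
  have Q_phi: "Q y \<le> P y 1 * Q (Suc x)" if "y \<le> x" "x < M" for x y
  proof -
    have "Q (Suc y) \<le> Q (Suc x)"
    proof -
      have "Q (Suc y) = (\<Prod>k=Suc y..<Suc x. P k 1) * Q (Suc x)"
        unfolding Q_def using that by (intro prod.atLeastLessThan_concat[symmetric]) auto
      also have "\<dots> \<le> 1 * Q (Suc x)"
        using that P1 by (intro mult_right_mono prod_le_1 Q01) auto
      finally show ?thesis by simp
    qed
    then show ?thesis using that P1 by (simp add: Q_step mult_left_mono)
  qed
  \<comment> \<open>With \<open>Q (Suc x)\<close> as common factor, the claim becomes
    \<open>P a 1 + (1 - P a 1) * P (x - a) 1 \<le> P x 1\<close>, which is \<open>phi\<close> at
    \<open>y = a\<close>.\<close>
  have Q_super: "P a 1 * Q (Suc x) + (1 - P a 1) * Q (x - a) \<le> Q x" if "a \<le> x" "x < M" for a x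
  proof -
    have "(1 - P a 1) * Q (x - a) \<le> (1 - P a 1) * (P (x - a) 1 * Q (Suc x))"
      using that P1[of a] by (intro mult_left_mono Q_phi) auto
    also have "\<dots> = (P (x - a) 1 * (1 - P a 1)) * Q (Suc x)" by simp
    also have "\<dots> \<le> (P x 1 - P a 1) * Q (Suc x)"
      using phi[of x a] that by (intro mult_right_mono Q01) (auto simp: algebra_simps)
    finally show ?thesis using that by (simp add: Q_step algebra_simps)
  qed
  \<comment> \<open>The product condition, used with second bid \<open>1\<close>, merges the first
    \<open>b\<close> unit steps into one bid of size \<open>b\<close>. The base case is
    \<open>P x 0 = 1\<close>, hence \<open>0 < x\<close>.\<close>
  have Q_P: "Q x \<le> P x b * Q (x + b)" if "0 < x" "x + b \<le> M" for x b
    using that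
  proof (induction b)
    case 0
    then show ?case using P_0[of x] by simp
  next
    case (Suc b)
    have "Q x \<le> (P x b * P (x + b) 1) * Q (Suc (x + b))"
      using Suc Q_step[of "x + b"] by simp
    also have "\<dots> \<le> P x (b + 1) * Q (Suc (x + b))"
      using P_mult[of x b 1] Suc.prems by (intro mult_right_mono Q01) auto
    finally show ?case by simp
  qed
  have timid_cases: "(last h < M \<and> timid_II M h = 1) \<or> (last h = M \<and> timid_II M h = 0)"
    if "h \<in> histories M" for h
    using last_history_le[OF that] by (auto simp: timid_II_def)
  have game: "game M x0 P \<sigma> \<tau>" if "\<sigma> \<in> strategies_I M" "\<tau> \<in> strategies_II M" for \<sigma> \<tau>
    using that x0M P by unfold_locales
  have upper_I: "win_I M P x0 \<sigma> (timid_II M) \<le> Q x0" if \<sigma>: "\<sigma> \<in> strategies_I M" for \<sigma>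
  proof -
    interpret game M x0 P \<sigma> "timid_II M" by (rule game[OF \<sigma> timid_II_strategy])
    have "measure (game_measure P x0 \<sigma> (timid_II M)) {\<omega>. \<exists>m. \<omega> m = M} \<le> Q x0"
    proof (rule measure_game_hits_le)
      fix h assume h: "h \<in> histories M"
      show "stage_mean Q h \<le> Q (last h)"
        \<comment> \<open>At \<open>last h = M\<close> player II bids \<open>0\<close> and
          admissibility gives \<open>0 < \<sigma> h\<close>, so \<open>P (\<sigma> h) 0 = 1\<close>
          and the fortune stays at \<open>M\<close>.\<close>
        using timid_cases[OF h] bids(1)[OF h] Q_super[of "\<sigma> h" "last h"] P_0[of "\<sigma> h"] M
        by (auto simp: admissible_bids_def)
    qed (simp_all add: Q01 QM)
    then show ?thesis by (simp add: win_I_def)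
  qed
  \<comment> \<open>At horizon \<open>M\<close> the alternative \<open>n < last h\<close> is
    excluded by \<open>last h \<le> M\<close>.\<close>
  have ends: "last h = 0 \<or> last h = M" if "h \<in> set_pmf (history_pmf P x0 bold_I (timid_II M) M)" for h
    using bold_timid_ends[of x0 M P h M] that assms(2) x0M P01_0
      set_history_pmf[OF bold_I_strategy timid_II_strategy x0M, of P M]
      last_history_le[of h M]
    by auto
  interpret bt: game M x0 P bold_I "timid_II M"
    by (rule game[OF bold_I_strategy timid_II_strategy])
  \<comment> \<open>A lost bold bid leads to \<open>0\<close>, where \<open>Q\<close> vanishes, so
    the recursion \<open>Q_step\<close> is exactly harmonicity. It serves both lower bounds, for
    \<open>Q\<close> and for \<open>1 - Q\<close>.\<close>
  have mean_bt: "bt.stage_mean Q h = Q (last h)" if "h \<in> histories M" for h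
    using timid_cases[OF that] Q_step[of "last h"] P_0[of M] M Q0 by (auto simp: bold_I_def)
  have lower_I: "Q x0 \<le> win_I M P x0 bold_I (timid_II M)"
    unfolding win_I_def space_game_measure
    by (simp, rule bt.measure_game_hits_ge[where n = M]) (use Q01 Q0 QM ends mean_bt in fastforce)+
  have win_II_eq: "win_II M P x0 \<sigma> \<tau> = measure (game_measure P x0 \<sigma> \<tau>) {\<omega>. \<exists>m. \<omega> m = 0}" for \<sigma> \<tau>
  proof -
    have "M - z = M \<longleftrightarrow> z = 0" for z using M by auto
    then show ?thesis by (simp add: win_II_def)
  qed
  have upper_II: "win_II M P x0 bold_I \<tau> \<le> 1 - Q x0" if \<tau>: "\<tau> \<in> strategies_II M" for \<tau>
  proof -
    interpret game M x0 P bold_I \<tau> by (rule game[OF bold_I_strategy \<tau>])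
    show ?thesis
      unfolding win_II_eq
    proof (rule measure_game_hits_le[where f = "\<lambda>x. 1 - Q x"])
      fix h assume h: "h \<in> histories M"
      then have b: "\<tau> h \<le> M - last h" "last h \<le> M" using bids[OF h] by (auto simp: admissible_bids_def)
      \<comment> \<open>Since a lost bold bid leads to \<open>Q 0 = 0\<close>, the stage mean of
        \<open>1 - Q\<close> is \<open>1 - P (last h) (\<tau> h) * Q (last h + \<tau> h)\<close>.
        The state \<open>0\<close>, outside the scope of \<open>Q_P\<close>, is treated
        separately.\<close>
      have "Q (last h) \<le> P (last h) (\<tau> h) * Q (last h + \<tau> h)"
      proof (cases "last h = 0")
        case True
        then show ?thesis using Q0 Q01 P[of 0 "\<tau> h"] b by simp
      next
        case False
        then show ?thesis using Q_P[of "last h" "\<tau> h"] b by simp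
      qed
      then show "stage_mean (\<lambda>x. 1 - Q x) h \<le> 1 - Q (last h)"
        by (simp add: bold_I_def Q0 algebra_simps)
    qed (simp_all add: Q01 Q0)
  qed
  have lower_II: "1 - Q x0 \<le> win_II M P x0 bold_I (timid_II M)"
    unfolding win_II_eq
  \<comment> \<open>The target is now \<open>0\<close>, where \<open>1 - Q\<close> equals
    \<open>1\<close>; the other terminal state \<open>M\<close> has \<open>1 - Q M = 0\<close>, so
    \<open>ends\<close> again yields the stopping condition.\<close>
  proof (rule bt.measure_game_hits_ge[where f = "\<lambda>x. 1 - Q x" and n = M])
    fix h assume "h \<in> histories M"
    from mean_bt[OF this]
    show "1 - Q (last h) \<le> bt.stage_mean (\<lambda>x. 1 - Q x) h" by (simp add: algebra_simps)
  qed (use Q01 Q0 QM ends in auto)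
  show ?thesis
    unfolding nash_equilibrium_def
    using bold_I_strategy timid_II_strategy upper_I lower_I upper_II lower_II
    by (blast intro: order_trans)
qed

end
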